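(* For integers $m,n\ge 3$: if $m$ and $n$ are both even then $\chi_{lat}(K_{m-1}\vee C_n)=m+1$, and if $m$ and $n$ are both odd then $\chi_{lat}(K_{m-1}\vee C_n)=m+2$.
   Context: Graphs are finite and simple. $G\vee H$ is the join of $G$ and $H$: the disjoint union of $G$ and $H$ together with all edges between $V(G)$ and $V(H)$. $K_{m-1}$ is the complete graph on $m-1$ vertices and $C_n$ the cycle on $n$ vertices. For a graph $G$ of order $p$ and size $q$, a local antimagic total labeling of $G$ is a bijection $f:V(G)\cup E(G)\to\{1,\ldots,p+q\}$ such that $w_f(u)\neq w_f(v)$ for every edge $uv$ of $G$, where $w_f(u)=f(u)+\sum_{ux\in E(G)}f(ux)$. $\chi_{lat}(G)$ is the minimum number of distinct values of $w_f$ over all local antimagic total labelings $f$ of $G$. *)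

theory Defs
  imports Main
begin

type_synonym 'a graph = "'a set \<times> 'a set set"

abbreviation verts :: "'a graph \<Rightarrow> 'a set" where
  "verts G \<equiv> fst G"

abbreviation edges :: "'a graph \<Rightarrow> 'a set set" where
  "edges G \<equiv> snd G"

definition finite_simple_graph :: "'a graph \<Rightarrow> bool" where
  "finite_simple_graph G \<longleftrightarrow>
     finite (verts G) \<and> (\<forall>e\<in>edges G. e \<subseteq> verts G \<and> card e = 2)"

definition complete_graph :: "nat \<Rightarrow> nat graph" where
  "complete_graph n = ({..<n}, {e. e \<subseteq> {..<n} \<and> card e = 2})"

text \<open>Meant for \<open>n \<ge> 3\<close>; for smaller \<open>n\<close> this is not a cycle.\<close>

definition cycle_graph :: "nat \<Rightarrow> nat graph" where
  "cycle_graph n = ({..<n}, {{i, (i + 1) mod n} | i. i < n})"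

definition graph_join :: "'a graph \<Rightarrow> 'b graph \<Rightarrow> ('a + 'b) graph" where
  "graph_join G H =
     (verts G <+> verts H,
      (\<lambda>e. Inl ` e) ` edges G \<union> (\<lambda>e. Inr ` e) ` edges H \<union>
      {{Inl u, Inr v} | u v. u \<in> verts G \<and> v \<in> verts H})"

text \<open>
  A total labeling is defined on the disjoint sum of vertices and edges:
  \<open>f (Inl u)\<close> is the label of the vertex \<open>u\<close>, \<open>f (Inr e)\<close> that of the edge \<open>e\<close>.
\<close>

definition weight :: "'a graph \<Rightarrow> ('a + 'a set \<Rightarrow> nat) \<Rightarrow> 'a \<Rightarrow> nat" where
  "weight G f u = f (Inl u) + (\<Sum>x | {u, x} \<in> edges G. f (Inr {u, x}))"

definition local_antimagic_total_labeling :: "'a graph \<Rightarrow> ('a + 'a set \<Rightarrow> nat) \<Rightarrow> bool" where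
  "local_antimagic_total_labeling G f \<longleftrightarrow>
     bij_betw f (verts G <+> edges G) {1..card (verts G) + card (edges G)} \<and>
     (\<forall>u v. {u, v} \<in> edges G \<longrightarrow> weight G f u \<noteq> weight G f v)"

text \<open>
  Every finite simple graph has a local antimagic total labeling (label the edges first and
  then the vertices in increasing order of the resulting edge sums), so the minimum is over
  a nonempty set.
\<close>

definition chi_lat :: "'a graph \<Rightarrow> nat" where
  "chi_lat G =
     (LEAST k. \<exists>f. local_antimagic_total_labeling G f \<and> card (weight G f ` verts G) = k)"

lemma finite_simple_complete_graph: "finite_simple_graph (complete_graph n)"
  by (simp add: finite_simple_graph_def complete_graph_def)

lemma finite_simple_cycle_graph:
  assumes "n \<ge> 3"
  shows "finite_simple_graph (cycle_graph n)"
proof -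
  have "i \<noteq> (i + 1) mod n" if "i < n" for i
    using that assms by (cases "i + 1 = n") auto
  then show ?thesis
    using assms by (auto simp: finite_simple_graph_def cycle_graph_def card_2_iff)
qed

lemma finite_simple_graph_join:
  assumes "finite_simple_graph G" "finite_simple_graph H"
  shows "finite_simple_graph (graph_join G H)"
  using assms
  by (fastforce simp: finite_simple_graph_def graph_join_def card_image)

end

theory Submission imports Defs begin

text \<open>
  Write \<open>k = m - 1\<close>. The value claimed is the chromatic number of the join, and it is a lower bound
  because the weights of a local antimagic total labeling form a proper colouring: the \<open>k\<close> clique
  vertices get distinct weights, none of them is used on the cycle, and the cycle needs two further
  values, or three if \<open>n\<close> is odd (\<open>card_weights_join_ge\<close>).

  For the upper bound, the labels are given out in three batches. The cycle edges get the smallest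
  ones, \<open>1, n, 2, n - 1, \<dots>\<close> around the cycle, so that the two edges at a cycle vertex sum
  alternately to \<open>n + 1\<close> and \<open>n + 2\<close>, except at the vertex where the sequence closes up. The next
  \<open>m * n\<close> labels go into an \<open>m \<times> n\<close> array whose row \<open>r\<close> holds a block of \<open>n\<close> consecutive labels in the
  order of some permutation. Row \<open>r < k\<close> labels the edges from clique vertex \<open>r\<close> to the cycle, and
  row \<open>k\<close> labels the cycle vertices themselves. Hence the weight of a cycle vertex is, up to a constant,
  its zigzag sum plus its column sum of the array of permutations. The remaining, largest, labels
  go to the clique. Its vertices are labeled last and greedily, which makes their weights
  distinct whatever the rest looks like (\<open>distinct_weights_labeling\<close>); having large labels they
  also exceed every weight on the cycle. Nothing is therefore required of the row sums, and
  it only remains to choose the permutations such that the cycle receives few weights.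

  If \<open>m\<close> and \<open>n\<close> are odd, the columns can have equal sums (\<open>three_row_array\<close>), and the zigzag gives the
  three values. If \<open>n\<close> is even, the cycle edges contribute the same total to the even and to the odd
  vertices, so constant column sums cannot produce two alternating weights. Instead two rows are
  chosen that repair the exceptional vertex at the expense of the odd ones (\<open>two_row_array\<close>). In both
  cases the other rows are added in pairs \<open>j, n - 1 - j\<close>, which change every column sum by the
  same amount.
\<close>

section \<open>Labelings of a join\<close>

definition neighbours :: "'a graph \<Rightarrow> 'a \<Rightarrow> 'a set" where
  "neighbours G u = {x. {u, x} \<in> edges G}"

text \<open>
  The labeling of a join assembled from labelings of the two parts and an array \<open>M\<close> for the edges
  between them. An edge of the join is recognised by which of its traces on the two
  summands is empty.
\<close>

definition join_labeling ::
  "('a + 'a set \<Rightarrow> nat) \<Rightarrow> ('b + 'b set \<Rightarrow> nat) \<Rightarrow> ('a \<Rightarrow> 'b \<Rightarrow> nat) \<Rightarrow>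
   ('a + 'b) + ('a + 'b) set \<Rightarrow> nat" where
  "join_labeling g h M x =
     (case x of
        Inl (Inl u) \<Rightarrow> g (Inl u)
      | Inl (Inr v) \<Rightarrow> h (Inl v)
      | Inr e \<Rightarrow>
          if Inr -` e = {} then g (Inr (Inl -` e))
          else if Inl -` e = {} then h (Inr (Inr -` e))
          else M (the_elem (Inl -` e)) (the_elem (Inr -` e)))"

lemma join_labeling_simps:
  "join_labeling g h M (Inl (Inl u)) = g (Inl u)"
  "join_labeling g h M (Inl (Inr v)) = h (Inl v)"
  "join_labeling g h M (Inr (Inl ` a)) = g (Inr a)"
  "b \<noteq> {} \<Longrightarrow> join_labeling g h M (Inr (Inr ` b)) = h (Inr b)"
  "join_labeling g h M (Inr {Inl u, Inr v}) = M u v"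
proof -
  have *: "Inl -` Inl ` a = a" "Inr -` Inl ` a = {}" "Inl -` Inr ` b = {}" "Inr -` Inr ` b = b"
    "Inl -` {Inl u, Inr v} = {u}" "Inr -` {Inl u, Inr v} = {v}" for a :: "'a set" and b :: "'b set"
    by auto
  show "join_labeling g h M (Inl (Inl u)) = g (Inl u)"
    "join_labeling g h M (Inl (Inr v)) = h (Inl v)"
    "join_labeling g h M (Inr (Inl ` a)) = g (Inr a)"
    "b \<noteq> {} \<Longrightarrow> join_labeling g h M (Inr (Inr ` b)) = h (Inr b)"
    "join_labeling g h M (Inr {Inl u, Inr v}) = M u v"
    by (simp_all add: join_labeling_def *)
qed

lemma edges_join_iff:
  "{Inl u, Inl u'} \<in> edges (graph_join G H) \<longleftrightarrow> {u, u'} \<in> edges G"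
  "{Inr v, Inr v'} \<in> edges (graph_join G H) \<longleftrightarrow> {v, v'} \<in> edges H"
  "{Inl u, Inr v} \<in> edges (graph_join G H) \<longleftrightarrow> u \<in> verts G \<and> v \<in> verts H"
  "{Inr v, Inl u} \<in> edges (graph_join G H) \<longleftrightarrow> u \<in> verts G \<and> v \<in> verts H"
proof -
  have inj: "Inl ` a = Inl ` a' \<longleftrightarrow> a = a'" "Inr ` b = Inr ` b' \<longleftrightarrow> b = b'"
    for a a' :: "'a set" and b b' :: "'b set"
    by (simp_all add: inj_image_eq_iff)
  have pair: "{Inl u, Inl u'} = Inl ` {u, u'}" "{Inr v, Inr v'} = Inr ` {v, v'}" by auto
  have ne: "Inl ` {u, u'} \<noteq> Inr ` b" "Inr ` {v, v'} \<noteq> Inl ` a"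
    for a :: "'a set" and b :: "'b set" by auto
  show "{Inl u, Inl u'} \<in> edges (graph_join G H) \<longleftrightarrow> {u, u'} \<in> edges G"
    unfolding pair graph_join_def using ne by (auto simp: inj simp del: image_insert)
  show "{Inr v, Inr v'} \<in> edges (graph_join G H) \<longleftrightarrow> {v, v'} \<in> edges H"
    unfolding pair graph_join_def using ne by (auto simp: inj simp del: image_insert)
  show "{Inl u, Inr v} \<in> edges (graph_join G H) \<longleftrightarrow> u \<in> verts G \<and> v \<in> verts H"
    by (auto simp: graph_join_def doubleton_eq_iff)
  then show "{Inr v, Inl u} \<in> edges (graph_join G H) \<longleftrightarrow> u \<in> verts G \<and> v \<in> verts H"
    by (simp add: insert_commute)
qed

lemma finite_neighbours:
  assumes "finite_simple_graph G"
  shows "finite (neighbours G u)"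
proof -
  have "neighbours G u \<subseteq> verts G"
    using assms by (auto simp: neighbours_def finite_simple_graph_def)
  then show ?thesis
    using assms finite_subset by (auto simp: finite_simple_graph_def)
qed

text \<open>
  Passing to the join adds to each vertex of one part exactly the edges to all vertices of the other,
  that is, a row sum or a column sum of \<open>M\<close>.
\<close>

lemma weight_join_labeling:
  assumes G: "finite_simple_graph G" and H: "finite_simple_graph H"
  shows weight_join_labeling_Inl:
      "u \<in> verts G \<Longrightarrow> weight (graph_join G H) (join_labeling g h M) (Inl u) =
         weight G g u + (\<Sum>v\<in>verts H. M u v)"
    and weight_join_labeling_Inr:
      "v \<in> verts H \<Longrightarrow> weight (graph_join G H) (join_labeling g h M) (Inr v) =
         weight H h v + (\<Sum>u\<in>verts G. M u v)"
proof -
  have fin: "finite (verts G)" "finite (verts H)"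
    using G H by (auto simp: finite_simple_graph_def)
  {
    assume u: "u \<in> verts G"
    have "{x. {Inl u, x} \<in> edges (graph_join G H)} = neighbours G u <+> verts H"
    proof (intro set_eqI)
      fix x :: "'a + 'b"
      show "x \<in> {x. {Inl u, x} \<in> edges (graph_join G H)} \<longleftrightarrow> x \<in> neighbours G u <+> verts H"
        using u by (cases x) (auto simp: edges_join_iff neighbours_def)
    qed
    moreover have "join_labeling g h M (Inr {Inl u, Inl x}) = g (Inr {u, x})" for x
      using join_labeling_simps(3)[of g h M "{u, x}"] by simp
    ultimately show "weight (graph_join G H) (join_labeling g h M) (Inl u) =
         weight G g u + (\<Sum>v\<in>verts H. M u v)"
      using finite_neighbours[OF G] fin
      by (simp add: weight_def sum.Plus join_labeling_simps neighbours_def)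
  }
  {
    assume v: "v \<in> verts H"
    have "{x. {Inr v, x} \<in> edges (graph_join G H)} = verts G <+> neighbours H v"
    proof (intro set_eqI)
      fix x :: "'a + 'b"
      show "x \<in> {x. {Inr v, x} \<in> edges (graph_join G H)} \<longleftrightarrow> x \<in> verts G <+> neighbours H v"
        using v by (cases x) (auto simp: edges_join_iff neighbours_def)
    qed
    moreover have "join_labeling g h M (Inr {Inr v, Inr x}) = h (Inr {v, x})" for x
      using join_labeling_simps(4)[of "{v, x}" g h M] by simp
    moreover have "join_labeling g h M (Inr {Inr v, Inl x}) = M x v" for x
      using join_labeling_simps(5)[of g h M x v] by (simp add: insert_commute)
    ultimately show "weight (graph_join G H) (join_labeling g h M) (Inr v) =
         weight H h v + (\<Sum>u\<in>verts G. M u v)"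
      using finite_neighbours[OF H] fin
      by (simp add: weight_def sum.Plus join_labeling_simps neighbours_def)
  }
qed

text \<open>
  The vertices and edges of the join are the disjoint union of copies of those of \<open>G\<close> and \<open>H\<close> and of
  \<open>verts G \<times> verts H\<close>, and the labeling acts on the copies as \<open>g\<close>, \<open>h\<close> and \<open>M\<close>.
  A function that is injective after composition with an embedding is injective on its image, so only
  the disjointness of the label sets matters.
\<close>

lemma bij_betw_join_labeling:
  fixes G :: "'a graph" and H :: "'b graph"
  assumes H: "finite_simple_graph H"
    and g: "bij_betw g (verts G <+> edges G) A"
    and h: "bij_betw h (verts H <+> edges H) B"
    and M: "bij_betw (\<lambda>(u, v). M u v) (verts G \<times> verts H) C"
    and disj: "A \<inter> B = {}" "(A \<union> B) \<inter> C = {}"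
  shows "bij_betw (join_labeling g h M)
    (verts (graph_join G H) <+> edges (graph_join G H)) (A \<union> B \<union> C)"
proof -
  let ?f = "join_labeling g h M"
  have ne: "e \<noteq> {}" if "e \<in> edges H" for e
    using H that by (auto simp: finite_simple_graph_def)
  define \<phi> where "\<phi> = map_sum (Inl :: 'a \<Rightarrow> 'a + 'b) (image (Inl :: 'a \<Rightarrow> 'a + 'b))"
  define \<psi> where "\<psi> = map_sum (Inr :: 'b \<Rightarrow> 'a + 'b) (image (Inr :: 'b \<Rightarrow> 'a + 'b))"
  define \<chi> where "\<chi> = (\<lambda>(u, v). Inr {Inl u, Inr v} :: ('a + 'b) + ('a + 'b) set)"
  let ?X = "verts G <+> edges G" and ?Y = "verts H <+> edges H" and ?Z = "verts G \<times> verts H"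
  have dom: "verts (graph_join G H) <+> edges (graph_join G H) = \<phi> ` ?X \<union> \<psi> ` ?Y \<union> \<chi> ` ?Z"
  proof -
    have "\<phi> ` ?X = Inl ` Inl ` verts G \<union> Inr ` image Inl ` edges G"
      "\<psi> ` ?Y = Inl ` Inr ` verts H \<union> Inr ` image Inr ` edges H"
      by (simp_all add: \<phi>_def \<psi>_def Plus_def image_Un image_image)
    moreover have "\<chi> ` ?Z = Inr ` {{Inl u, Inr v} | u v. u \<in> verts G \<and> v \<in> verts H}"
      by (auto simp: \<chi>_def)
    ultimately show ?thesis
      by (simp only: graph_join_def fst_conv snd_conv Plus_def image_Un Un_ac)
  qed
  have comp: "?f (\<phi> x) = g x" "y \<in> ?Y \<Longrightarrow> ?f (\<psi> y) = h y" "?f (\<chi> z) = (case z of (u, v) \<Rightarrow> M u v)"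
    for x y z
    unfolding \<phi>_def \<psi>_def \<chi>_def
    by (auto simp: join_labeling_simps ne split: sum.splits prod.splits)
       (cases x; simp add: join_labeling_simps)
  have transfer: "bij_betw ?f (\<tau> ` S) T" if "bij_betw t S T" "\<And>s. s \<in> S \<Longrightarrow> ?f (\<tau> s) = t s"
    for \<tau> :: "'c \<Rightarrow> ('a + 'b) + ('a + 'b) set" and t S T
  proof -
    have "bij_betw (?f \<circ> \<tau>) S T"
      using that by (subst bij_betw_cong[where g = t]) auto
    then show ?thesis
      by (auto simp: bij_betw_def image_comp intro: inj_on_imageI)
  qed
  have "bij_betw ?f (\<phi> ` ?X) A" "bij_betw ?f (\<psi> ` ?Y) B" "bij_betw ?f (\<chi> ` ?Z) C"
    using transfer[OF g] transfer[OF h] transfer[OF M] comp by auto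
  then show ?thesis
    unfolding dom using disj by (intro bij_betw_combine) auto
qed

section \<open>Greedy labelings of an arbitrary graph\<close>

text \<open>
  Giving the labels in the order of increasing \<open>s\<close> makes both summands of \<open>h u + s u\<close> increase along
  that order, the first one strictly.
\<close>

lemma greedy_increasing_labels:
  fixes s :: "'a \<Rightarrow> nat"
  assumes "finite V"
  shows "\<exists>h. bij_betw h V {a<..a + card V} \<and> inj_on (\<lambda>u. h u + s u) V"
  using assms
proof (induction V rule: finite_ranking_induct[where f = s])
  case empty
  then show ?case by (simp add: bij_betw_def)
next
  case (insert x V)
  then obtain h where h: "bij_betw h V {a<..a + card V}" "inj_on (\<lambda>u. h u + s u) V"
    by auto
  show ?case
  proof (cases "x \<in> V")
    case True
    then show ?thesis using h by (auto simp: insert_absorb)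
  next
    case False
    let ?h = "h(x := Suc (a + card V))"
    have lt: "h u + s u < Suc (a + card V) + s x" if "u \<in> V" for u
    proof -
      have "h u \<in> {a<..a + card V}" using h(1) that by (rule bij_betw_apply)
      moreover have "s u \<le> s x" using insert(2) that by blast
      ultimately show ?thesis by simp
    qed
    have "bij_betw ?h V {a<..a + card V}"
      using h(1) False by (subst bij_betw_cong[where g = h]) auto
    then have "bij_betw ?h (insert x V) (insert (Suc (a + card V)) {a<..a + card V})"
      using False notIn_Un_bij_betw3[of x V ?h "{a<..a + card V}"] by simp
    moreover have "insert (Suc (a + card V)) {a<..a + card V} = {a<..a + card (insert x V)}"
      using False insert(1) by auto
    moreover have "inj_on (\<lambda>u. ?h u + s u) (insert x V)"
    proof -
      have "inj_on (\<lambda>u. ?h u + s u) V"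
        using h(2) False by (subst inj_on_cong[where g = "\<lambda>u. h u + s u"]) auto
      moreover have "?h x + s x \<noteq> ?h u + s u" if "u \<in> V" for u
        using lt[OF that] that False by (cases "u = x") simp_all
      ultimately show ?thesis
        using False by (auto simp: inj_on_insert)
    qed
    ultimately show ?thesis by metis
  qed
qed

text \<open>
  Label the edges arbitrarily and the vertices greedily afterwards. The function \<open>s\<close> stands for what
  the edges leaving \<open>G\<close> contribute when \<open>G\<close> is part of a larger graph.
\<close>

lemma distinct_weights_labeling:
  assumes G: "finite_simple_graph G"
  shows "\<exists>g. bij_betw g (verts G <+> edges G) {a<..a + card (verts G) + card (edges G)} \<and>
             inj_on (\<lambda>u. weight G g u + s u) (verts G)"
proof -
  have fin: "finite (verts G)" "finite (edges G)"
    using G finite_subset[of "edges G" "Pow (verts G)"] by (auto simp: finite_simple_graph_def)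
  let ?b = "a + card (edges G)"
  obtain ge where ge: "bij_betw ge (edges G) {a<..?b}"
    using fin(2) finite_same_card_bij[of "edges G" "{a<..?b}"] by auto
  obtain gv where gv: "bij_betw gv (verts G) {?b<..?b + card (verts G)}"
    and inj: "inj_on (\<lambda>u. gv u + ((\<Sum>x\<in>neighbours G u. ge {u, x}) + s u)) (verts G)"
    using greedy_increasing_labels[OF fin(1), of ?b "\<lambda>u. (\<Sum>x\<in>neighbours G u. ge {u, x}) + s u"] by blast
  have "bij_betw (case_sum gv ge) (verts G <+> edges G) {a<..a + card (verts G) + card (edges G)}"
  proof -
    have "bij_betw (case_sum gv ge) (Inl ` verts G) {?b<..?b + card (verts G)}"
      "bij_betw (case_sum gv ge) (Inr ` edges G) {a<..?b}"
      using gv ge by (auto simp: bij_betw_def inj_on_def image_image)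
    from bij_betw_combine[OF this] show ?thesis
      by (simp add: Plus_def ivl_disj_un ac_simps Int_commute disjoint_iff)
  qed
  moreover have "inj_on (\<lambda>u. weight G (case_sum gv ge) u + s u) (verts G)"
    using inj by (simp add: weight_def neighbours_def add.assoc)
  ultimately show ?thesis by blast
qed

section \<open>Complete graphs and cycles\<close>

lemma weight_complete_graph_ge:
  assumes u: "u < k" and g: "\<And>x. x \<in> verts (complete_graph k) <+> edges (complete_graph k) \<Longrightarrow> g x \<ge> b"
  shows "weight (complete_graph k) g u \<ge> k * b"
proof -
  have nb: "{x. {u, x} \<in> edges (complete_graph k)} = {..<k} - {u}"
    using u by (auto simp: complete_graph_def card_insert_if)
  have "(\<Sum>x\<in>{..<k} - {u}. b) \<le> (\<Sum>x\<in>{..<k} - {u}. g (Inr {u, x}))"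
    using nb g by (intro sum_mono) (metis InrI mem_Collect_eq)
  moreover have "g (Inl u) \<ge> b"
    using g u by (auto simp: complete_graph_def)
  ultimately show ?thesis
    using u unfolding weight_def nb by (cases k) auto
qed

lemma inj_on_cycle_edges:
  fixes n :: nat
  assumes "n \<ge> 3"
  shows "inj_on (\<lambda>j. {j, (j + 1) mod n}) {..<n}"
proof (rule inj_onI)
  fix i j
  assume ij: "i \<in> {..<n}" "j \<in> {..<n}" "{i, (i + 1) mod n} = {j, (j + 1) mod n}"
  show "i = j"
    using ij assms by (auto simp: doubleton_eq_iff mod_Suc split: if_splits)
qed

text \<open>
  Vertex \<open>j\<close> gets \<open>p j\<close> and the edge from \<open>j\<close> to its successor gets \<open>q j\<close>. Edges are sets, so the index
  of an edge has to be recovered from it, which is possible for \<open>n \<ge> 3\<close>.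
\<close>

definition cycle_labeling :: "nat \<Rightarrow> (nat \<Rightarrow> nat) \<Rightarrow> (nat \<Rightarrow> nat) \<Rightarrow> nat + nat set \<Rightarrow> nat" where
  "cycle_labeling n p q = case_sum p (\<lambda>e. q (inv_into {..<n} (\<lambda>j. {j, (j + 1) mod n}) e))"

lemma cycle_labeling_edge:
  assumes "n \<ge> 3" "j < n"
  shows "cycle_labeling n p q (Inr {j, (j + 1) mod n}) = q j"
  using inv_into_f_f[OF inj_on_cycle_edges[OF assms(1)], of j] assms(2)
  by (simp add: cycle_labeling_def)

lemma weight_cycle_labeling:
  assumes n: "n \<ge> 3" and j: "j < n"
  shows "weight (cycle_graph n) (cycle_labeling n p q) j = p j + q j + q ((j + n - 1) mod n)"
proof -
  let ?i = "(j + n - 1) mod n" and ?k = "(j + 1) mod n"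
  have i: "?i < n" "(?i + 1) mod n = j" "?i \<noteq> ?k"
  proof -
    have i: "?i = (if j = 0 then n - 1 else j - 1)"
      using n j by (auto simp: mod_if)
    show "?i < n" "(?i + 1) mod n = j" "?i \<noteq> ?k"
      unfolding i using n j by (auto simp: mod_if)
  qed
  have "{x. {j, x} \<in> edges (cycle_graph n)} = {?k, ?i}"
  proof (intro set_eqI iffI)
    fix x assume "x \<in> {x. {j, x} \<in> edges (cycle_graph n)}"
    then obtain l where l: "l < n" "{j, x} = {l, (l + 1) mod n}"
      by (auto simp: cycle_graph_def)
    then have "j = l \<and> x = ?k \<or> j = (l + 1) mod n \<and> x = l"
      by (auto simp: doubleton_eq_iff)
    moreover have "?i = l" if "j = (l + 1) mod n"
      using that l(1) n by (cases "l + 1 = n") auto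
    ultimately show "x \<in> {?k, ?i}" by auto
  next
    fix x assume "x \<in> {?k, ?i}"
    then have "x \<in> {?k} \<or> x \<in> {?i}" by auto
    then show "x \<in> {x. {j, x} \<in> edges (cycle_graph n)}"
    proof
      assume "x \<in> {?i}"
      then have "{j, x} = {?i, (?i + 1) mod n}" using i(2) by auto
      then show ?thesis using i(1) unfolding cycle_graph_def by auto
    next
      assume "x \<in> {?k}"
      then show ?thesis using j by (auto simp: cycle_graph_def)
    qed
  qed
  moreover have "cycle_labeling n p q (Inr {j, ?i}) = q ?i"
    using cycle_labeling_edge[OF n i(1), of p q] i(2) by (simp add: insert_commute)
  moreover have "cycle_labeling n p q (Inr {j, ?k}) = q j"
    using cycle_labeling_edge[OF n j] .
  ultimately show ?thesis
    using i(3) by (simp add: weight_def) (simp add: cycle_labeling_def)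
qed

lemma bij_betw_cycle_labeling:
  assumes n: "n \<ge> 3" and p: "bij_betw p {..<n} A" and q: "bij_betw q {..<n} B"
    and disj: "A \<inter> B = {}"
  shows "bij_betw (cycle_labeling n p q) (verts (cycle_graph n) <+> edges (cycle_graph n)) (A \<union> B)"
proof -
  let ?E = "\<lambda>j. {j, (j + 1) mod n}"
  have E: "edges (cycle_graph n) = ?E ` {..<n}"
    by (auto simp: cycle_graph_def)
  have "bij_betw (inv_into {..<n} ?E) (edges (cycle_graph n)) {..<n}"
    unfolding E by (intro bij_betw_inv_into) (simp add: bij_betw_def inj_on_cycle_edges[OF n, simplified])
  from bij_betw_trans[OF this q] have "bij_betw (cycle_labeling n p q) (Inr ` edges (cycle_graph n)) B"
    by (auto simp: bij_betw_def inj_on_def image_image cycle_labeling_def)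
  moreover have "bij_betw (cycle_labeling n p q) (Inl ` verts (cycle_graph n)) A"
    using p by (auto simp: bij_betw_def inj_on_def image_image cycle_labeling_def cycle_graph_def)
  ultimately show ?thesis
    using disj unfolding Plus_def by (intro bij_betw_combine) auto
qed

lemma bij_betw_cardI:
  assumes "inj_on f A" "f ` A \<subseteq> B" "finite B" "card A = card B"
  shows "bij_betw f A B"
  using assms by (simp add: bij_betw_def card_image card_subset_eq)

lemma bij_betw_lessThanI:
  fixes f :: "nat \<Rightarrow> nat"
  assumes "inj_on f {..<n}" "\<And>j. j < n \<Longrightarrow> f j < n"
  shows "bij_betw f {..<n} {..<n}"
  using assms by (intro bij_betw_cardI) auto

section \<open>Arrays of permutations with prescribed column sums\<close>

definition permutation_array :: "nat \<Rightarrow> nat \<Rightarrow> (nat \<Rightarrow> nat \<Rightarrow> nat) \<Rightarrow> (nat \<Rightarrow> nat) \<Rightarrow> bool" where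
  "permutation_array m n P c \<longleftrightarrow>
     (\<forall>r<m. bij_betw (P r) {..<n} {..<n}) \<and> (\<forall>j<n. (\<Sum>r<m. P r j) = c j)"

text \<open>The identity and its reversal together add \<open>n - 1\<close> to every column.\<close>

lemma permutation_array_add_row_pairs:
  assumes "permutation_array m n P c"
  shows "\<exists>P. permutation_array (m + 2 * t) n P (\<lambda>j. c j + t * (n - 1))"
proof (induction t)
  case 0
  then show ?case using assms by auto
next
  case (Suc t)
  then obtain P where P: "permutation_array (m + 2 * t) n P (\<lambda>j. c j + t * (n - 1))"
    by blast
  define M where "M = m + 2 * t"
  define Q where "Q r j = (if r < M then P r j else if r = M then j else n - 1 - j)" for r j
  have "bij_betw (\<lambda>j. n - 1 - j) {..<n} {..<n}"
    by (intro bij_betw_lessThanI inj_onI) auto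
  then have "\<forall>r<M + 2. bij_betw (Q r) {..<n} {..<n}"
    using P unfolding permutation_array_def Q_def M_def[symmetric]
    by (auto simp: less_Suc_eq bij_betw_def)
  moreover have "(\<Sum>r<M + 2. Q r j) = c j + Suc t * (n - 1)" if "j < n" for j
  proof -
    have "(\<Sum>r<M. Q r j) = (\<Sum>r<M. P r j)" by (simp add: Q_def)
    then show ?thesis
      using P that by (simp add: permutation_array_def Q_def M_def[symmetric])
  qed
  ultimately have "permutation_array (M + 2) n Q (\<lambda>j. c j + Suc t * (n - 1))"
    by (simp add: permutation_array_def)
  then show ?case by (auto simp: M_def)
qed

text \<open>
  Let \<open>l = n div 2\<close>. Two permutations \<open>p\<close> and \<open>q = n - 1 - \<sigma> \<circ> p\<close> have the column sums
  \<open>n - 1 + (p j - \<sigma> (p j))\<close>. Here \<open>\<sigma>\<close> is the cyclic shift of \<open>{0..l}\<close>: it moves each of the \<open>l\<close> values below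
  \<open>l\<close> up by one, brings \<open>l\<close> down to 0, and fixes everything above. So a column loses one if \<open>p\<close>
  has a value below \<open>l\<close> there and gains \<open>l\<close> if it has the value \<open>l\<close>. The \<open>p\<close> below
  puts the small values at the odd positions and \<open>l\<close> at position 0.
\<close>

lemma two_row_array:
  assumes n: "even n" "n \<ge> 2"
  shows "\<exists>P. permutation_array 2 n P
    (\<lambda>j. if j = 0 then n - 1 + n div 2 else if even j then n - 1 else n - 2)"
proof -
  obtain l where l: "n = 2 * l" "l \<ge> 1" using n by auto
  define p where "p j = (if even j then l + j div 2 else j div 2)" for j
  define q where "q j = (if j = 0 then n - 1 else if even j then n - 1 - l - j div 2 else n - 2 - j div 2)" for j
  have "inj_on p {..<n}" "\<And>j. j < n \<Longrightarrow> p j < n"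
    unfolding p_def inj_on_def using l by (auto elim!: evenE oddE)
  moreover have "inj_on q {..<n}" "\<And>j. j < n \<Longrightarrow> q j < n"
    unfolding q_def inj_on_def using l by (auto elim!: evenE oddE)
  ultimately have "bij_betw p {..<n} {..<n}" "bij_betw q {..<n} {..<n}"
    by (auto intro!: bij_betw_lessThanI)
  moreover have "p j + q j = (if j = 0 then n - 1 + n div 2 else if even j then n - 1 else n - 2)"
    if "j < n" for j
    unfolding p_def q_def using l that by (auto elim!: evenE oddE)
  ultimately show ?thesis
    by (intro exI[of _ "\<lambda>r. if r = 0 then p else q"])
      (auto simp: permutation_array_def numeral_2_eq_2)
qed

text \<open>
  For \<open>n = 2 * l + 1\<close> the permutation \<open>p\<close> is chosen such that \<open>j + p j\<close> runs through the consecutive values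
  \<open>l, \<dots>, 3 * l\<close>, each taken once: \<open>l + i\<close> at \<open>j = 2 * i\<close> and \<open>2 * l + i + 1\<close> at
  \<open>j = 2 * i + 1\<close>. Its complement to \<open>3 * l\<close> is then a third permutation.
\<close>

lemma three_row_array:
  assumes n: "odd n"
  shows "\<exists>P. permutation_array 3 n P (\<lambda>j. 3 * (n div 2))"
proof -
  obtain l where l: "n = 2 * l + 1" using n by (auto elim: oddE)
  define p where "p j = (if even j then l - j div 2 else 2 * l - j div 2)" for j
  define q where "q j = 3 * l - (j + p j)" for j
  have "inj_on p {..<n}" "\<And>j. j < n \<Longrightarrow> p j < n"
    unfolding p_def inj_on_def using l by (auto elim!: evenE oddE)
  moreover have "inj_on q {..<n}" "\<And>j. j < n \<Longrightarrow> q j < n"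
    unfolding q_def p_def inj_on_def using l by (auto elim!: evenE oddE)
  ultimately have "bij_betw p {..<n} {..<n}" "bij_betw q {..<n} {..<n}"
    by (auto intro!: bij_betw_lessThanI)
  moreover have "j + p j + q j = 3 * l" if "j < n" for j
    unfolding p_def q_def using l that by (auto elim!: evenE oddE)
  ultimately show ?thesis
    using l by (intro exI[of _ "\<lambda>r. if r = 0 then \<lambda>j. j else if r = 1 then p else q"])
      (auto simp: permutation_array_def numeral_3_eq_3 bij_betw_def inj_on_def)
qed

text \<open>The sequence \<open>1, n, 2, n - 1, 3, \<dots>\<close>\<close>

definition zigzag :: "nat \<Rightarrow> nat \<Rightarrow> nat" where
  "zigzag n j = (if even j then j div 2 + 1 else n - j div 2)"

lemma bij_betw_zigzag: "bij_betw (zigzag n) {..<n} {0<..n}"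
proof (intro bij_betw_cardI)
  show "inj_on (zigzag n) {..<n}"
    unfolding zigzag_def inj_on_def by (auto elim!: evenE oddE)
  show "zigzag n ` {..<n} \<subseteq> {0<..n}"
    unfolding zigzag_def by (auto elim!: evenE oddE)
qed auto

text \<open>
  The exceptional sum at 0 joins the two ends of the sequence: 1, and the middle value
  \<open>n div 2 + 1\<close> at which the zigzag stops, whatever the parity of \<open>n\<close>.
\<close>

lemma zigzag_adjacent_sum:
  assumes n: "n \<ge> 1" and j: "j < n"
  shows "zigzag n j + zigzag n ((j + n - 1) mod n) =
    (if j = 0 then n div 2 + 2 else if even j then n + 2 else n + 1)"
proof -
  have "(j + n - 1) mod n = (if j = 0 then n - 1 else j - 1)"
    using n j by (auto simp: mod_if)
  then show ?thesis
    using n j unfolding zigzag_def by (cases "even n") (auto elim!: evenE oddE)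
qed

section \<open>The upper bound\<close>

text \<open>
  Division by \<open>n\<close> recovers the row from an entry, and then the permutation of that row recovers the column.
\<close>

lemma bij_betw_block_array:
  assumes "\<And>r. r \<in> R \<Longrightarrow> r < k \<and> bij_betw (P r) {..<n} {..<n}" "card R = k" "finite R"
  shows "bij_betw (\<lambda>(r, j). n + r * n + P r j + 1) (R \<times> {..<n :: nat}) {n<..n + k * n}"
proof (intro bij_betw_cardI)
  have lt: "P r j < n" if "r \<in> R" "j < n" for r j
    using assms(1)[of r] that by (auto simp: bij_betw_def)
  show "inj_on (\<lambda>(r, j). n + r * n + P r j + 1) (R \<times> {..<n})"
  proof (intro inj_onI, clarsimp)
    fix r j r' j'
    assume *: "r \<in> R" "r' \<in> R" "j < n" "j' < n" "r * n + P r j = r' * n + P r' j'"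
    then have "(r * n + P r j) div n = (r' * n + P r' j') div n" by simp
    then have "r = r'" using lt[OF *(1,3)] lt[OF *(2,4)] by (simp add: div_mult_self3)
    then show "r = r' \<and> j = j'"
      using * assms(1)[of r] by (auto simp: bij_betw_def inj_on_def)
  qed
  have "n + r * n + P r j + 1 \<in> {n<..n + k * n}" if "r \<in> R" "j < n" for r j
  proof -
    have "(r + 1) * n \<le> k * n" using assms(1)[of r] that by (intro mult_right_mono) auto
    then show ?thesis using lt[OF that] by auto
  qed
  then show "(\<lambda>(r, j). n + r * n + P r j + 1) ` (R \<times> {..<n}) \<subseteq> {n<..n + k * n}"
    by auto
qed (use assms in auto)

text \<open>
  The function \<open>w\<close> gives the weights of the cycle vertices up to a common constant. The bound on it says
  (doubled, to stay within the natural numbers) that \<open>w\<close> exceeds the average column sum of the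
  permutations by at most \<open>n + 2\<close>. This keeps the weights on the cycle below those of the clique: a
  weight on the cycle is at most that of \<open>k + 1\<close> average entries of the array plus the small amount
  \<open>n + 2\<close>, while a clique vertex has \<open>k\<close> labels that are all larger than the whole array, and \<open>n\<close>
  entries of the array in addition.
\<close>

lemma join_labeling_exists:
  fixes k n :: nat
  defines "G \<equiv> graph_join (complete_graph k) (cycle_graph n)"
  assumes k: "k \<ge> 2" and n: "n \<ge> 3"
    and P: "permutation_array (k + 1) n P c"
    and w: "\<And>j. j < n \<Longrightarrow> w j = zigzag n j + zigzag n ((j + n - 1) mod n) + c j"
    and proper: "\<And>j. j < n \<Longrightarrow> w j \<noteq> w ((j + 1) mod n)"
    and bound: "\<And>j. j < n \<Longrightarrow> 2 * w j \<le> (k + 1) * (n - 1) + 2 * n + 4"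
  shows "\<exists>f. local_antimagic_total_labeling G f \<and>
             card (weight G f ` verts G) = k + card (w ` {..<n})"
proof -
  let ?K = "complete_graph k" and ?C = "cycle_graph n"
  have simple: "finite_simple_graph ?K" "finite_simple_graph ?C"
    using n by (simp_all add: finite_simple_complete_graph finite_simple_cycle_graph)
  have verts: "verts ?K = {..<k}" "verts ?C = {..<n}"
    by (simp_all add: complete_graph_def cycle_graph_def)
  have permP: "bij_betw (P r) {..<n} {..<n}" if "r \<le> k" for r
    using P that by (simp add: permutation_array_def)
  define M where "M r j = n + r * n + P r j + 1" for r j
  define a where "a = n + (k + 1) * n"
  define h where "h = cycle_labeling n (M k) (zigzag n)"
  obtain g where g: "bij_betw g (verts ?K <+> edges ?K) {a<..a + card (verts ?K) + card (edges ?K)}"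
    and g_inj: "inj_on (\<lambda>u. weight ?K g u + (\<Sum>v\<in>verts ?C. M u v)) (verts ?K)"
    using distinct_weights_labeling[OF simple(1), of a "\<lambda>u. \<Sum>v\<in>verts ?C. M u v"] by blast
  have Mk: "bij_betw (M k) {..<n} {n + k * n<..a}"
  proof (intro bij_betw_cardI)
    show "inj_on (M k) {..<n}"
      using permP[of k] by (auto simp: bij_betw_def inj_on_def M_def)
    have "P k j < n" if "j < n" for j
      using permP[of k] that by (auto simp: bij_betw_def)
    then show "M k ` {..<n} \<subseteq> {n + k * n<..a}"
      by (fastforce simp: M_def a_def)
  qed (simp_all add: a_def)
  have h: "bij_betw h (verts ?C <+> edges ?C) ({n + k * n<..a} \<union> {0<..n})"
    unfolding h_def by (intro bij_betw_cycle_labeling[OF n Mk bij_betw_zigzag]) auto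
  have M: "bij_betw (\<lambda>(u, v). M u v) (verts ?K \<times> verts ?C) {n<..n + k * n}"
    unfolding M_def verts using permP by (intro bij_betw_block_array) auto
  let ?f = "join_labeling g h M"
  let ?A = "{a<..a + card (verts ?K) + card (edges ?K)}"
  have "bij_betw ?f (verts G <+> edges G) (?A \<union> ({n + k * n<..a} \<union> {0<..n}) \<union> {n<..n + k * n})"
    unfolding G_def by (intro bij_betw_join_labeling[OF simple(2) g h M]) (auto simp: a_def)
  moreover have "?A \<union> ({n + k * n<..a} \<union> {0<..n}) \<union> {n<..n + k * n} =
      {1..a + card (verts ?K) + card (edges ?K)}"
    by (auto simp: a_def)
  ultimately have bij: "bij_betw ?f (verts G <+> edges G) {1..a + card (verts ?K) + card (edges ?K)}"
    by simp
  moreover have "card (verts G) + card (edges G) = a + card (verts ?K) + card (edges ?K)"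
  proof -
    have "finite (verts G)" "finite (edges G)"
      using finite_simple_graph_join[OF simple] finite_subset[of "edges G" "Pow (verts G)"]
      by (auto simp: finite_simple_graph_def G_def)
    then show ?thesis
      using bij_betw_same_card[OF bij] by (simp add: card_Plus)
  qed
  ultimately have bij: "bij_betw ?f (verts G <+> edges G) {1..card (verts G) + card (edges G)}"
    by simp

  \<comment> \<open>The offsets of the blocks contribute the same amount to each cycle vertex.\<close>
  define D where "D = (\<Sum>r<k + 1. n + r * n + 1)"
  have wC: "weight G ?f (Inr j) = D + w j" if j: "j < n" for j
  proof -
    have "weight G ?f (Inr j) = zigzag n j + zigzag n ((j + n - 1) mod n) + (\<Sum>r<k + 1. M r j)"
      unfolding G_def using j weight_join_labeling_Inr[OF simple, of j g h M]
        weight_cycle_labeling[OF n j, of "M k" "zigzag n"] by (simp add: verts h_def)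
    also have "(\<Sum>r<k + 1. M r j) = (\<Sum>r<k + 1. (n + r * n + 1) + P r j)"
      by (simp add: M_def)
    also have "\<dots> = D + c j"
      unfolding sum.distrib D_def using P j by (simp add: permutation_array_def)
    finally show ?thesis using w[OF j] by simp
  qed
  have wK: "weight G ?f (Inl u) = weight ?K g u + (\<Sum>v\<in>verts ?C. M u v)" if "u < k" for u
    unfolding G_def using that weight_join_labeling_Inl[OF simple, of u g h M] by (simp add: verts)
  have injK: "inj_on (\<lambda>u. weight G ?f (Inl u)) {..<k}"
    using g_inj wK by (auto simp: verts inj_on_def)
  have less: "weight G ?f (Inr j) < weight G ?f (Inl u)" if u: "u < k" and j: "j < n" for u j
  proof -
    have K: "k * (a + 1) \<le> weight ?K g u"
      using g by (intro weight_complete_graph_ge u) (auto simp: bij_betw_def Suc_le_eq)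
    have S: "n * (n + 1) \<le> (\<Sum>v\<in>verts ?C. M u v)"
      using sum_mono[of "verts ?C" "\<lambda>_. n + 1" "M u"] by (simp add: M_def verts)
    have D: "2 * D = 2 * (k + 1) * (n + 1) + n * k * (k + 1)"
      unfolding D_def by (induction k) (simp_all add: algebra_simps)
    \<comment> \<open>After this substitution the difference of the two sides is a polynomial in \<open>x\<close> and \<open>y\<close> with
      nonnegative coefficients.\<close>
    obtain x y where "k = 2 + x" "n = 3 + y"
      using k n le_Suc_ex by blast
    then have ineq: "2 * (k + 1) * (n + 1) + n * k * (k + 1) + ((k + 1) * (n - 1) + 2 * n + 4)
        < 2 * (k * (a + 1) + n * (n + 1))"
      by (simp add: a_def algebra_simps)
    have "2 * (D + w j) \<le> 2 * (k + 1) * (n + 1) + n * k * (k + 1) + ((k + 1) * (n - 1) + 2 * n + 4)"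
      unfolding distrib_left D using bound[OF j] by (rule add_left_mono)
    also note ineq
    also have "2 * (k * (a + 1) + n * (n + 1)) \<le> 2 * (weight ?K g u + (\<Sum>v\<in>verts ?C. M u v))"
      using add_mono[OF K S] by simp
    finally show ?thesis
      using wC[OF j] wK[OF u] by simp
  qed

  have "weight G ?f x \<noteq> weight G ?f y" if "{x, y} \<in> edges G" for x y
  proof (cases x)
    case x: (Inl u)
    show ?thesis
    proof (cases y)
      case y: (Inl u')
      from that have "u < k" "u' < k" "u \<noteq> u'"
        unfolding x y G_def edges_join_iff by (auto simp: complete_graph_def)
      then show ?thesis using injK by (auto simp: x y inj_on_def)
    next
      case y: (Inr v)
      from that show ?thesis
        unfolding x y G_def edges_join_iff using less[unfolded G_def] by (fastforce simp: verts)
    qed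
  next
    case x: (Inr v)
    show ?thesis
    proof (cases y)
      case y: (Inl u)
      from that show ?thesis
        unfolding x y G_def edges_join_iff using less[unfolded G_def] by (fastforce simp: verts)
    next
      case y: (Inr v')
      from that obtain j where j: "j < n" "{v, v'} = {j, (j + 1) mod n}"
        unfolding x y G_def edges_join_iff by (auto simp: cycle_graph_def)
      then have "v < n" "v' < n" "w v \<noteq> w v'"
        using proper[of j] n by (auto simp: doubleton_eq_iff)
      then show ?thesis using wC by (simp add: x y)
    qed
  qed
  then have "local_antimagic_total_labeling G ?f"
    using bij by (simp add: local_antimagic_total_labeling_def)
  moreover have "card (weight G ?f ` verts G) = k + card (w ` {..<n})"
  proof -
    have "weight G ?f ` verts G =
        (\<lambda>u. weight G ?f (Inl u)) ` {..<k} \<union> (\<lambda>j. weight G ?f (Inr j)) ` {..<n}"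
      by (auto simp: G_def graph_join_def verts image_Un Plus_def image_image)
    also have "(\<lambda>j. weight G ?f (Inr j)) ` {..<n} = (+) D ` w ` {..<n}"
      using wC by (simp add: image_image)
    also have "card ((\<lambda>u. weight G ?f (Inl u)) ` {..<k} \<union> (+) D ` w ` {..<n}) =
        k + card (w ` {..<n})"
      using less wC injK by (subst card_Un_disjoint) (fastforce simp: card_image)+
    finally show ?thesis .
  qed
  ultimately show ?thesis by blast
qed

section \<open>The lower bound\<close>

lemma proper_cycle_colouring_ge_2:
  fixes n :: nat
  assumes n: "n \<ge> 3" and proper: "\<And>j. j < n \<Longrightarrow> c j \<noteq> c ((j + 1) mod n)"
  shows "card (c ` {..<n}) \<ge> 2"
proof -
  have "c 0 \<noteq> c 1" using proper[of 0] n by simp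
  then have "2 = card (c ` {0, 1})" by simp
  also have "\<dots> \<le> card (c ` {..<n})"
    using n by (intro card_mono image_mono) auto
  finally show ?thesis .
qed

text \<open>
  With two colours the colour would be constant on the even positions, but for odd \<open>n\<close> the even
  positions 0 and \<open>n - 1\<close> are adjacent.
\<close>

lemma proper_odd_cycle_colouring_ge_3:
  fixes n :: nat
  assumes n: "n \<ge> 3" "odd n" and proper: "\<And>j. j < n \<Longrightarrow> c j \<noteq> c ((j + 1) mod n)"
  shows "card (c ` {..<n}) \<ge> 3"
proof (rule ccontr)
  assume "\<not> ?thesis"
  then have "card (c ` {..<n}) = 2"
    using proper_cycle_colouring_ge_2[of n c] n proper by fastforce
  then obtain x y where xy: "c ` {..<n} = {x, y}"
    by (auto simp: card_2_iff)
  have two: "c (Suc (Suc j)) = c j" if "Suc (Suc j) < n" for j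
  proof -
    have "c j \<in> {x, y}" "c (Suc j) \<in> {x, y}" "c (Suc (Suc j)) \<in> {x, y}"
      using that unfolding xy[symmetric] by auto
    moreover have "c j \<noteq> c (Suc j)" "c (Suc j) \<noteq> c (Suc (Suc j))"
      using proper[of j] proper[of "Suc j"] that by simp_all
    ultimately show ?thesis by auto
  qed
  have "2 * i < n \<Longrightarrow> c (2 * i) = c 0" for i
    by (induction i) (auto simp: two)
  from this[of "n div 2"] have "c (n - 1) = c 0"
    using n by (auto elim!: oddE)
  with proper[of "n - 1"] n show False by simp
qed

text \<open>
  The parameter \<open>l\<close> is any lower bound for the number of colours of a proper colouring of the cycle, so that
  both parities are covered.
\<close>

lemma card_weights_join_ge:
  fixes k n :: nat
  defines "G \<equiv> graph_join (complete_graph k) (cycle_graph n)"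
  assumes f: "local_antimagic_total_labeling G f" and n: "n \<ge> 3"
    and cycle: "\<And>c :: nat \<Rightarrow> nat. (\<And>j. j < n \<Longrightarrow> c j \<noteq> c ((j + 1) mod n)) \<Longrightarrow> card (c ` {..<n}) \<ge> l"
  shows "card (weight G f ` verts G) \<ge> k + l"
proof -
  have ne: "weight G f x \<noteq> weight G f y" if "{x, y} \<in> edges G" for x y
    using f that by (auto simp: local_antimagic_total_labeling_def)
  let ?A = "(\<lambda>u. weight G f (Inl u)) ` {..<k}" and ?B = "(\<lambda>j. weight G f (Inr j)) ` {..<n}"
  have "inj_on (\<lambda>u. weight G f (Inl u)) {..<k}"
    using ne[of "Inl u" "Inl u'" for u u', unfolded G_def edges_join_iff]
    by (fastforce simp: inj_on_def complete_graph_def G_def card_insert_if)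
  then have "card ?A = k" by (simp add: card_image)
  moreover have "card ?B \<ge> l"
  proof (rule cycle)
    show "weight G f (Inr j) \<noteq> weight G f (Inr ((j + 1) mod n))" if "j < n" for j
      using that by (intro ne) (auto simp: G_def edges_join_iff cycle_graph_def)
  qed
  moreover have "?A \<inter> ?B = {}"
    using ne[of "Inl u" "Inr v" for u v, unfolded G_def edges_join_iff]
    by (fastforce simp: complete_graph_def cycle_graph_def G_def)
  moreover have "weight G f ` verts G = ?A \<union> ?B"
    by (auto simp: G_def graph_join_def complete_graph_def cycle_graph_def image_Un Plus_def image_image)
  ultimately show ?thesis by (simp add: card_Un_disjoint)
qed

section \<open>The two parities\<close>

lemma chi_lat_join_eqI:
  fixes k n :: nat
  defines "G \<equiv> graph_join (complete_graph k) (cycle_graph n)"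
  assumes "k \<ge> 2" "n \<ge> 3"
    and "permutation_array (k + 1) n P c"
    and "\<And>j. j < n \<Longrightarrow> w j = zigzag n j + zigzag n ((j + n - 1) mod n) + c j"
    and "\<And>j. j < n \<Longrightarrow> w j \<noteq> w ((j + 1) mod n)"
    and "\<And>j. j < n \<Longrightarrow> 2 * w j \<le> (k + 1) * (n - 1) + 2 * n + 4"
    and "card (w ` {..<n}) = l"
    and "\<And>c :: nat \<Rightarrow> nat. (\<And>j. j < n \<Longrightarrow> c j \<noteq> c ((j + 1) mod n)) \<Longrightarrow> card (c ` {..<n}) \<ge> l"
  shows "chi_lat G = k + l"
  unfolding chi_lat_def
proof (rule Least_equality)
  show "\<exists>f. local_antimagic_total_labeling G f \<and> card (weight G f ` verts G) = k + l"
    using join_labeling_exists[of k n P c w] assms by auto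
  show "k + l \<le> y" if "\<exists>f. local_antimagic_total_labeling G f \<and> card (weight G f ` verts G) = y" for y
    using that card_weights_join_ge[of k n _ l] assms by auto
qed

text \<open>
  The zigzag sums \<open>n div 2 + 2\<close> at 0, \<open>n + 2\<close> at the other even and \<open>n + 1\<close> at the odd positions meet the column sums
  \<open>n - 1 + n div 2\<close>, \<open>n - 1\<close> and \<open>n - 2\<close> of the two special rows: all even positions get \<open>2 * n + 1\<close>
  and all odd ones \<open>2 * n - 1\<close>.
\<close>

lemma chi_lat_join_even:
  assumes m: "m \<ge> 3" "even m" and n: "n \<ge> 3" "even n"
  shows "chi_lat (graph_join (complete_graph (m - 1)) (cycle_graph n)) = m - 1 + 2"
proof -
  have t: "m = 2 + 2 * t" if "t = m div 2 - 1" for t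
    using m that by (auto elim!: evenE)
  then obtain t where t: "m = 2 + 2 * t" by blast
  let ?c = "\<lambda>j. if j = 0 then n - 1 + n div 2 else if even j then n - 1 else n - 2"
  obtain P where P: "permutation_array m n P (\<lambda>j. ?c j + t * (n - 1))"
    using two_row_array[of n] permutation_array_add_row_pairs[of 2 n _ ?c t] n t by auto
  define w where "w j = (if even j then 2 * n + 1 else 2 * n - 1) + t * (n - 1)" for j :: nat
  have w: "w j = zigzag n j + zigzag n ((j + n - 1) mod n) + (?c j + t * (n - 1))" if "j < n" for j
    using zigzag_adjacent_sum[of n j] n that by (auto simp: w_def elim!: evenE)
  have proper: "w j \<noteq> w ((j + 1) mod n)" if "j < n" for j
    using that n by (cases "j + 1 = n") (auto simp: w_def)
  have bound: "2 * w j \<le> m * (n - 1) + 2 * n + 4" for j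
    using n by (auto simp: w_def t algebra_simps)
  have card: "card (w ` {..<n}) = 2"
  proof -
    have "w ` {..<n} = {w 0, w 1}"
    proof
      show "w ` {..<n} \<subseteq> {w 0, w 1}" by (auto simp: w_def)
      show "{w 0, w 1} \<subseteq> w ` {..<n}" using n by auto
    qed
    then show ?thesis using n by (simp add: w_def)
  qed
  have Suc_m: "m - 1 + 1 = m" using m by simp
  show ?thesis
    by (rule chi_lat_join_eqI[of "m - 1" n, unfolded Suc_m, OF _ n(1) P w proper bound card
            proper_cycle_colouring_ge_2[OF n(1)]]) (use m in auto)
qed

lemma chi_lat_join_odd:
  assumes m: "m \<ge> 3" "odd m" and n: "n \<ge> 3" "odd n"
  shows "chi_lat (graph_join (complete_graph (m - 1)) (cycle_graph n)) = m - 1 + 3"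
proof -
  have t: "m = 3 + 2 * t" if "t = m div 2 - 1" for t
    using m that by (auto elim!: oddE)
  then obtain t where t: "m = 3 + 2 * t" by blast
  obtain P where P: "permutation_array m n P (\<lambda>j. 3 * (n div 2) + t * (n - 1))"
    using three_row_array[of n] permutation_array_add_row_pairs[of 3 n _ "\<lambda>j. 3 * (n div 2)" t] n t by auto
  define w where "w j = (if j = 0 then n div 2 + 2 else if even j then n + 2 else n + 1) +
      (3 * (n div 2) + t * (n - 1))" for j :: nat
  have w: "w j = zigzag n j + zigzag n ((j + n - 1) mod n) + (3 * (n div 2) + t * (n - 1))" if "j < n" for j
    using zigzag_adjacent_sum[of n j] n that by (auto simp: w_def)
  have proper: "w j \<noteq> w ((j + 1) mod n)" if "j < n" for j
    using that n by (cases "j + 1 = n") (auto simp: w_def elim!: oddE)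
  have bound: "2 * w j \<le> m * (n - 1) + 2 * n + 4" for j
    using n by (auto simp: w_def t algebra_simps elim!: oddE)
  have card: "card (w ` {..<n}) = 3"
  proof -
    have "w ` {..<n} = {w 0, w 1, w 2}"
    proof
      show "w ` {..<n} \<subseteq> {w 0, w 1, w 2}" by (auto simp: w_def split: if_splits)
      show "{w 0, w 1, w 2} \<subseteq> w ` {..<n}" using n by auto
    qed
    then show ?thesis using n by (auto simp: w_def elim!: oddE)
  qed
  have Suc_m: "m - 1 + 1 = m" using m by simp
  show ?thesis
    by (rule chi_lat_join_eqI[of "m - 1" n, unfolded Suc_m, OF _ n(1) P w proper bound card
            proper_odd_cycle_colouring_ge_3[OF n]]) (use m in auto)
qed

theorem theorem3p18:
  fixes m n :: nat
  assumes "m \<ge> 3" and "n \<ge> 3"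
  shows "(even m \<and> even n \<longrightarrow>
            chi_lat (graph_join (complete_graph (m - 1)) (cycle_graph n)) = m + 1) \<and>
         (odd m \<and> odd n \<longrightarrow>
            chi_lat (graph_join (complete_graph (m - 1)) (cycle_graph n)) = m + 2)"
  using assms chi_lat_join_even[of m n] chi_lat_join_odd[of m n] by auto

end
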